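(* Let $u,v,q$ be complex parameters (generic, so no denominator vanishes). Let $K_6(0)=K_6(1)=K_6(2)=1$ and $K_6(n):=K(q,q^{-n},q^{1-n},q^{2-n},q^{3-n},u,v,q^4)$ for $n\ge3$. Put \[ G_r:=\frac{(q^4u,q^4v,q^5/u,q^5/v;q^4)_r}{(u,v,q/u,q/v;q^4)_r},\qquad H_r:=\frac{(q^3u,q^3v,q^4/u,q^4/v;q^4)_r}{(u/q,v/q,1/u,1/v;q^4)_r}. \] (i) The sequences with $\alpha_0=\beta_0=1$, $\alpha_{4r+2}=0$ ($r\ge0$), and \[ \alpha_{4r}=G_rq^{8r^2-10r}+H_rq^{8r^2-6r}\ (r\ge1),\quad \alpha_{4r+1}=-G_rq^{8r^2-2r+1}\ (r\ge0),\quad \alpha_{4r-1}=-H_rq^{8r^2-14r+1}\ (r\ge1), \] \[ \beta_n=K_6(n)\frac{(-q^2;q^2)_{n-1}}{(q;q)_{2n}}\ (n\ge1), \] form a Bailey pair relative to $a=1$. (ii) The sequences with $\alpha_0=\beta_0=1$, $\alpha_{4r+2}=0$ ($r\ge0$), and \[ \alpha_{4r}=G_rq^{8r^2-6r}+H_rq^{8r^2-10r}\ (r\ge1),\quad \alpha_{4r+1}=-G_rq^{8r^2-6r}\ (r\ge0),\quad \alpha_{4r-1}=-H_rq^{8r^2-10r}\ (r\ge1), \] \[ \beta_n=K_6(n)\frac{q^n(-q^2;q^2)_{n-1}}{(q;q)_{2n}}\ (n\ge1), \] form a Bailey pair relative to $a=1$.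
   Context: Notation: $(x;q)_n=\prod_{k=0}^{n-1}(1-xq^k)$ and $(x_1,\dots,x_k;q)_n=(x_1;q)_n\cdots(x_k;q)_n$. A pair of sequences $(\alpha_n)_{n\ge0},(\beta_n)_{n\ge0}$ is a Bailey pair relative to $a$ if $\alpha_0=1$ and $\beta_n=\sum_{j=0}^{n}\frac{\alpha_j}{(q;q)_{n-j}(aq;q)_{n+j}}$ for all $n\ge0$. The function $K$: for complex $a,b,c,d,e,u,v$ and a base $p$, let $\sigma_1,\dots,\sigma_4$ be the elementary symmetric functions of $b,c,d,e$ and \[ K(a,b,c,d,e,u,v,p):=\frac{uv(\sigma_3-a\sigma_1)(p\sigma_3-a\sigma_1)a^2+(1-p)uv(a^2-\sigma_4)(a^2-\sigma_2a+\sigma_4)a+(u+v)(a+uv)(\sigma_3-a\sigma_1)(a^2-p\sigma_4)a+(u^2+a)(v^2+a)(a^2-\sigma_4)(a^2-p\sigma_4)}{(a^2-bcde)(a^2-bcde\,p)(1-u)(a-u)(1-v)(a-v)}. \] *)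

theory Defs
  imports Complex_Main
begin

definition qpoch :: "complex \<Rightarrow> complex \<Rightarrow> nat \<Rightarrow> complex" where
  "qpoch x q n = (\<Prod>k<n. 1 - x * q ^ k)"

definition qpochs :: "complex list \<Rightarrow> complex \<Rightarrow> nat \<Rightarrow> complex" where
  "qpochs xs q n = (\<Prod>x\<leftarrow>xs. qpoch x q n)"

definition bailey_pair ::
  "complex \<Rightarrow> complex \<Rightarrow> (nat \<Rightarrow> complex) \<Rightarrow> (nat \<Rightarrow> complex) \<Rightarrow> bool" where
  "bailey_pair q a \<alpha> \<beta> \<longleftrightarrow>
     \<alpha> 0 = 1 \<and>
     (\<forall>n. \<beta> n = (\<Sum>j\<le>n. \<alpha> j / (qpoch q q (n - j) * qpoch (a * q) q (n + j))))"

definition K ::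
  "complex \<Rightarrow> complex \<Rightarrow> complex \<Rightarrow> complex \<Rightarrow> complex \<Rightarrow> complex \<Rightarrow> complex \<Rightarrow> complex \<Rightarrow> complex"
  where
  "K a b c d e u v p =
     (let \<sigma>1 = b + c + d + e;
          \<sigma>2 = b * c + b * d + b * e + c * d + c * e + d * e;
          \<sigma>3 = b * c * d + b * c * e + b * d * e + c * d * e;
          \<sigma>4 = b * c * d * e
      in (u * v * (\<sigma>3 - a * \<sigma>1) * (p * \<sigma>3 - a * \<sigma>1) * a\<^sup>2
          + (1 - p) * u * v * (a\<^sup>2 - \<sigma>4) * (a\<^sup>2 - \<sigma>2 * a + \<sigma>4) * a
          + (u + v) * (a + u * v) * (\<sigma>3 - a * \<sigma>1) * (a\<^sup>2 - p * \<sigma>4) * a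
          + (u\<^sup>2 + a) * (v\<^sup>2 + a) * (a\<^sup>2 - \<sigma>4) * (a\<^sup>2 - p * \<sigma>4))
         / ((a\<^sup>2 - b * c * d * e) * (a\<^sup>2 - b * c * d * e * p)
            * (1 - u) * (a - u) * (1 - v) * (a - v)))"

definition K6 :: "complex \<Rightarrow> complex \<Rightarrow> complex \<Rightarrow> nat \<Rightarrow> complex" where
  "K6 q u v n =
     (if n \<le> 2 then 1
      else K q (q powi (- int n)) (q powi (1 - int n)) (q powi (2 - int n)) (q powi (3 - int n))
             u v (q ^ 4))"

definition G :: "complex \<Rightarrow> complex \<Rightarrow> complex \<Rightarrow> nat \<Rightarrow> complex" where
  "G q u v r =
     qpochs [q ^ 4 * u, q ^ 4 * v, q ^ 5 / u, q ^ 5 / v] (q ^ 4) r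
     / qpochs [u, v, q / u, q / v] (q ^ 4) r"

definition H :: "complex \<Rightarrow> complex \<Rightarrow> complex \<Rightarrow> nat \<Rightarrow> complex" where
  "H q u v r =
     qpochs [q ^ 3 * u, q ^ 3 * v, q ^ 4 / u, q ^ 4 / v] (q ^ 4) r
     / qpochs [u / q, v / q, 1 / u, 1 / v] (q ^ 4) r"

(* Exactly the non-vanishing of all denominators.  Those of K6 need no separate clause:
   1 - u, q - u, 1 - v, q - v are nonzero by the third line with r = 1 (as u, v are nonzero),
   and for n >= 3 the factors q^2 - q^(6-4n), q^2 - q^(10-4n) are nonzero since
   the second line says that q is not a root of unity. *)
definition generic_params :: "complex \<Rightarrow> complex \<Rightarrow> complex \<Rightarrow> bool" where
  "generic_params q u v \<longleftrightarrow>
     q \<noteq> 0 \<and> u \<noteq> 0 \<and> v \<noteq> 0 \<and>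
     (\<forall>n. qpoch q q n \<noteq> 0) \<and>
     (\<forall>r. qpochs [u, v, q / u, q / v] (q ^ 4) r \<noteq> 0) \<and>
     (\<forall>r. qpochs [u / q, v / q, 1 / u, 1 / v] (q ^ 4) r \<noteq> 0)"

end

theory Submission
  imports Defs
begin

text \<open>
  Since \<open>H r = q powi (16 * r) * G (- r)\<close> when \<open>G\<close> is continued to negative indices, both sums
  fold into one bilateral sum over \<open>s\<close>, the second being \<open>q ^ n\<close> times the first.
  With \<open>z = q powi (- 4 * s) + q powi (4 * s + 1)\<close> the summand is a constant multiple of
  \<open>(z - (u + q / u)) * (z - (v + q / v))\<close> times a very-well-poised term free of \<open>u\<close> and \<open>v\<close>.
  Multiplication of that term by \<open>z\<close> is a combination of the terms for \<open>n\<close> and \<open>n - 1\<close>, so the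
  bilateral sum without \<open>u\<close> and \<open>v\<close> suffices. That sum (a case of Bailey's 6-psi-6 summation) is
  evaluated by induction on \<open>n\<close> from a three-term recurrence over all integers \<open>j\<close> in place of
  \<open>4 * s\<close>, using the antisymmetry under \<open>j \<mapsto> - j - 1\<close> of the term.
\<close>

section \<open>Shift quotients of q-Pochhammer symbols and folding of sums modulo 4\<close>

lemma qpoch_Suc: "qpoch x p (Suc n) = qpoch x p n * (1 - x * p ^ n)"
  by (simp add: qpoch_def)

lemma qpoch_shift: "qpoch (p * x) p r * (1 - x) = qpoch x p r * (1 - x * p ^ r)"
proof (induction r)
  case (Suc r)
  have "qpoch (p * x) p (Suc r) * (1 - x) = qpoch (p * x) p r * (1 - x) * (1 - x * p ^ Suc r)"
    by (simp add: qpoch_Suc mult_ac)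
  then show ?case unfolding Suc by (simp add: qpoch_Suc mult_ac)
qed (simp add: qpoch_def)

text \<open>Multiplying an argument by the base shifts its factors by one place, so each quotient
  telescopes to its last factor over its first. Applied to \<open>G\<close> and \<open>H\<close>,
  this leaves a rational function of \<open>p ^ r\<close>, which can be continued to negative
  \<open>r\<close>.\<close>

lemma qpochs_shift_ratio:
  assumes "qpochs [x, y, z, t] p r \<noteq> 0" "(1 - x) * (1 - y) * (1 - z) * (1 - t) \<noteq> 0"
  shows "qpochs [p * x, p * y, p * z, p * t] p r / qpochs [x, y, z, t] p r
    = (1 - x * p ^ r) * (1 - y * p ^ r) * (1 - z * p ^ r) * (1 - t * p ^ r)
      / ((1 - x) * (1 - y) * (1 - z) * (1 - t))"
proof -
  have "qpochs [p * x, p * y, p * z, p * t] p r * ((1 - x) * (1 - y) * (1 - z) * (1 - t))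
    = (qpoch (p * x) p r * (1 - x)) * (qpoch (p * y) p r * (1 - y))
      * (qpoch (p * z) p r * (1 - z)) * (qpoch (p * t) p r * (1 - t))"
    by (simp add: qpochs_def mult_ac)
  also have "\<dots> = (1 - x * p ^ r) * (1 - y * p ^ r) * (1 - z * p ^ r) * (1 - t * p ^ r) * qpochs [x, y, z, t] p r"
    unfolding qpoch_shift by (simp add: qpochs_def mult_ac)
  finally show ?thesis using assms by (simp add: frac_eq_eq)
qed

lemma triangular_succ: "(j + 1) * j div 2 = j * (j - 1) div 2 + (j::int)"
proof -
  have "(j + 1) * j = j * (j - 1) + j * 2" by (simp add: algebra_simps)
  then show ?thesis by simp
qed

lemma triangular_4: "(4 * s) * (4 * s - 1) div 2 = 8 * s\<^sup>2 - 2 * (s::int)"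
proof -
  have "(4 * s) * (4 * s - 1) = (8 * s\<^sup>2 - 2 * s) * 2"
    by (simp add: algebra_simps power2_eq_square)
  then show ?thesis by simp
qed

text \<open>Natural indices are cut into the blocks 4r-2, 4r-1, 4r, 4r+1, and the block of
  \<open>r\<close> is matched with the pair of integers \<open>r\<close> and \<open>- r\<close>;
  only the indices 0 and 1 go with \<open>s = 0\<close>.\<close>

lemma sum_fold_integers:
  fixes a :: "nat \<Rightarrow> 'a :: comm_monoid_add" and h :: "int \<Rightarrow> 'a"
  assumes "h 0 = a 0 + a 1"
    and "\<And>r. r \<ge> 1 \<Longrightarrow> h (int r) + h (- int r) = a (4 * r - 2) + a (4 * r - 1) + a (4 * r) + a (4 * r + 1)"
  shows "(\<Sum>j\<le>4 * m + 1. a j) = (\<Sum>s\<in>{- int m..int m}. h s)"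
proof (induction m)
  case 0
  then show ?case using assms(1) by simp
next
  case (Suc m)
  have "{- int (Suc m)..int (Suc m)} = insert (int (Suc m)) (insert (- int (Suc m)) {- int m..int m})"
    by auto
  then have "(\<Sum>s\<in>{- int (Suc m)..int (Suc m)}. h s)
      = (\<Sum>s\<in>{- int m..int m}. h s) + (h (int (Suc m)) + h (- int (Suc m)))"
    by (simp add: add_ac)
  moreover have i: "4 * Suc m - 2 = 4 * m + 2" "4 * Suc m - 1 = 4 * m + 3" "4 * Suc m = 4 * m + 4"
    "4 * m + 4 + 1 = 4 * m + 5"
    by simp_all
  ultimately have "(\<Sum>s\<in>{- int (Suc m)..int (Suc m)}. h s) = (\<Sum>j\<le>4 * m + 1. a j)
      + (a (4 * m + 2) + a (4 * m + 3) + a (4 * m + 4) + a (4 * m + 5))"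
    using assms(2)[of "Suc m", unfolded i] Suc.IH by (simp add: add.commute[of 3])
  also have "\<dots> = (\<Sum>j\<le>4 * Suc m + 1. a j)"
    by (simp add: eval_nat_numeral add_ac)
  finally show ?case by simp
qed

section \<open>The very-well-poised term and its recurrences\<close>

locale non_root_of_unity =
  fixes q :: complex
  assumes q_nz: "q \<noteq> 0"
    and pow_neq_1: "\<And>k. k \<ge> 1 \<Longrightarrow> q ^ k \<noteq> 1"
begin

text \<open>The usual convention that 1/(q;q)_k is zero for negative k. It makes the bilateral sums
  below terminate by themselves.\<close>

definition rq :: "int \<Rightarrow> complex" where
  "rq k = (if k < 0 then 0 else 1 / qpoch q q (nat k))"

lemma qpoch_nz: "qpoch q q n \<noteq> 0"
proof -
  have "1 - q * q ^ k \<noteq> 0" for k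
    using pow_neq_1[of "Suc k"] by simp
  then show ?thesis by (simp add: qpoch_def)
qed

text \<open>At \<open>k = 0\<close> the factor \<open>1 - q powi 0\<close> is zero, in agreement
  with \<open>rq (- 1) = 0\<close>. The rule therefore holds at every integer, and the recurrences
  built on it need no boundary cases.\<close>

lemma rq_pred: "rq (k - 1) = (1 - q powi k) * rq k"
proof -
  consider "k < 0" | "k = 0" | m where "k = int (Suc m)"
    by (metis linorder_neqE_linordered_idom zero_less_imp_eq_int gr0_implies_Suc of_nat_0_less_iff)
  then show ?thesis
  proof cases
    case 3
    have *: "1 - q * q ^ m \<noteq> 0"
      using pow_neq_1[of "Suc m"] by simp
    have "nat (k - 1) = m" "nat k = Suc m" "q powi k = q * q ^ m"
      using 3 by (simp_all add: power_int_def nat_add_distrib)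
    with 3 * show ?thesis
      by (simp add: rq_def qpoch_Suc qpoch_nz)
  qed (auto simp: rq_def)
qed

text \<open>Up to the sign (-1)^j this is the j-th summand of beta_n for the unit Bailey pair
  relative to a = q, continued to all integers j. That sign is constant on each residue class modulo
  4, and the sums below run over such classes.\<close>

definition wp_term :: "int \<Rightarrow> int \<Rightarrow> complex" where
  "wp_term n j = q powi (j * (j - 1) div 2) * (1 - q powi (2 * j + 1)) * rq (n - j) * rq (n + j + 1)"

text \<open>The reflection exchanges the two \<open>rq\<close> factors. The quadratic exponent grows
  by exactly \<open>2 * j + 1\<close>, which turns \<open>1 - q powi (- (2 * j + 1))\<close> into
  the negative of the original factor.\<close>

lemma wp_term_antisym: "wp_term n (- j - 1) = - wp_term n j"
proof -
  have e: "(- j - 1) * (- j - 1 - 1) div 2 = j * (j - 1) div 2 + (2 * j + 1)"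
  proof -
    have "(- j - 1) * (- j - 1 - 1) = j * (j - 1) + (2 * j + 1) * 2" by (simp add: algebra_simps)
    then show ?thesis by simp
  qed
  have p: "q powi (2 * j + 1) * q powi (- (2 * j + 1)) = 1"
    using q_nz by (simp flip: power_int_add)
  have o: "2 * (- j - 1) + 1 = - (2 * j + 1)" "n - (- j - 1) = n + j + 1" "n + (- j - 1) + 1 = n - j"
    by simp_all
  have "wp_term n (- j - 1) = q powi (j * (j - 1) div 2)
      * (q powi (2 * j + 1) * (1 - q powi (- (2 * j + 1)))) * rq (n + j + 1) * rq (n - j)"
    unfolding wp_term_def e o using q_nz by (simp add: power_int_add)
  also have "q powi (2 * j + 1) * (1 - q powi (- (2 * j + 1))) = - (1 - q powi (2 * j + 1))"
    using p by (simp add: algebra_simps)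
  finally show ?thesis by (simp only: wp_term_def mult_minus_left mult_minus_right mult_ac)
qed

lemma wp_term_support: "j > n \<or> j < - n - 1 \<Longrightarrow> wp_term n j = 0"
  by (auto simp: wp_term_def rq_def)

text \<open>Lowering \<open>n\<close> costs one linear factor from each \<open>rq\<close>, and the
  product of the two depends on \<open>j\<close> only through
  \<open>q powi (- j) + q powi (j + 1)\<close>. Solved for that quantity times the term, this yields
  \<open>moment_Suc\<close>.\<close>

lemma wp_term_lower:
  "wp_term (n - 1) j = (1 + q powi (2 * n + 1) - q powi n * (q powi (- j) + q powi (j + 1))) * wp_term n j"
proof -
  have "rq (n - 1 - j) = (1 - q powi (n - j)) * rq (n - j)"
    using rq_pred[of "n - j"] by (simp add: algebra_simps)
  moreover have "rq (n - 1 + j + 1) = (1 - q powi (n + j + 1)) * rq (n + j + 1)"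
    using rq_pred[of "n + j + 1"] by (simp add: algebra_simps)
  moreover have "(1 - q powi (n - j)) * (1 - q powi (n + j + 1))
      = 1 + q powi (2 * n + 1) - q powi n * (q powi (- j) + q powi (j + 1))"
  proof -
    have "q powi (2 * n + 1) = q powi (n - j) * q powi (n + j + 1)"
      using q_nz by (simp flip: power_int_add)
    moreover have "q powi (n - j) = q powi n * q powi (- j)"
      using q_nz by (simp flip: power_int_add)
    moreover have "q powi (n + j + 1) = q powi n * q powi (j + 1)"
      using q_nz by (simp flip: power_int_add add: add.assoc)
    ultimately show ?thesis by (simp add: algebra_simps)
  qed
  ultimately show ?thesis
    unfolding wp_term_def by (simp add: mult.assoc mult.left_commute)
qed

text \<open>All four terms are the common factor \<open>W * X\<close> times a rational function of
  \<open>y = q powi j\<close> and \<open>z = q powi n\<close>, so the claim is a rational identity.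
  The coefficients do not involve \<open>j\<close>, hence the recurrence can be summed over a
  residue class of \<open>j\<close>.\<close>

lemma wp_term_rec:
  "(1 - q powi (2 * n)) * (1 - q powi (2 * n - 1)) * wp_term n j
    = (1 + q powi (2 * n - 2)) * wp_term (n - 1) j
      + q powi (n - 1) * (wp_term (n - 1) (j - 1) + wp_term (n - 1) (j + 1))"
proof -
  define y where "y = q powi j"
  define z where "z = q powi n"
  define W where "W = q powi (j * (j - 1) div 2)"
  define X where "X = rq (n - j) * rq (n + j + 1)"
  have y0: "y \<noteq> 0" using q_nz by (simp add: y_def)
  have sq: "q powi (2 * k) = (q powi k)\<^sup>2" for k
    using power_int_mult[of q k 2] by (simp add: mult.commute)
  note pw = power_int_add power_int_diff sq
  have m1: "rq (n - 1 - j) * rq (n - 1 + j + 1) = (1 - z / y) * (1 - z * y * q) * X"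
  proof -
    have "rq (n - 1 - j) = (1 - z / y) * rq (n - j)"
      using rq_pred[of "n - j"] q_nz by (simp add: algebra_simps pw y_def z_def)
    moreover have "rq (n - 1 + j + 1) = (1 - z * y * q) * rq (n + j + 1)"
      using rq_pred[of "n + j + 1"] q_nz by (simp add: algebra_simps pw y_def z_def)
    ultimately show ?thesis by (simp add: X_def)
  qed
  have m2: "rq (n - 1 - (j - 1)) * rq (n - 1 + (j - 1) + 1) = (1 - z * y) * (1 - z * y * q) * X"
  proof -
    have "rq (n + j) = (1 - z * y * q) * rq (n + j + 1)"
      using rq_pred[of "n + j + 1"] q_nz by (simp add: algebra_simps pw y_def z_def)
    moreover have "rq (n + j - 1) = (1 - z * y) * rq (n + j)"
      using rq_pred[of "n + j"] q_nz by (simp add: algebra_simps pw y_def z_def)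
    moreover have "n - 1 - (j - 1) = n - j" "n - 1 + (j - 1) + 1 = n + j - 1" by simp_all
    ultimately show ?thesis by (simp add: X_def)
  qed
  have m3: "rq (n - 1 - (j + 1)) * rq (n - 1 + (j + 1) + 1) = (1 - z / y) * (1 - z / y / q) * X"
  proof -
    have "rq (n - j - 1) = (1 - z / y) * rq (n - j)"
      using rq_pred[of "n - j"] q_nz by (simp add: pw y_def z_def)
    moreover have "rq (n - j - 1 - 1) = (1 - z / y / q) * rq (n - j - 1)"
      using rq_pred[of "n - j - 1"] q_nz by (simp add: pw y_def z_def)
    moreover have "n - 1 - (j + 1) = n - j - 1 - 1" "n - 1 + (j + 1) + 1 = n + j + 1" by simp_all
    ultimately show ?thesis by (simp add: X_def)
  qed
  have w0: "wp_term n j = W * (1 - y\<^sup>2 * q) * X"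
    using q_nz by (simp add: wp_term_def W_def X_def y_def pw)
  have w1: "wp_term (n - 1) j = W * (1 - y\<^sup>2 * q) * ((1 - z / y) * (1 - z * y * q) * X)"
    unfolding m1[symmetric] using q_nz by (simp add: wp_term_def W_def y_def pw)
  have Wp: "q powi ((j + 1) * (j + 1 - 1) div 2) = W * y"
    using triangular_succ[of j] q_nz by (simp add: W_def y_def pw)
  have Wm: "q powi ((j - 1) * (j - 1 - 1) div 2) = W * q / y"
    using triangular_succ[of "j - 1"] q_nz
    by (simp add: W_def y_def pw mult.commute[of j])
  have w2: "wp_term (n - 1) (j - 1) = W * q / y * (1 - y\<^sup>2 / q) * ((1 - z * y) * (1 - z * y * q) * X)"
  proof -
    have "2 * (j - 1) + 1 = 2 * j - 1" by simp
    then have "q powi (2 * (j - 1) + 1) = y\<^sup>2 / q"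
      using q_nz by (simp add: y_def pw power2_eq_square del: right_diff_distrib_numeral)
    then show ?thesis unfolding m2[symmetric] wp_term_def Wm by (simp only: mult.assoc)
  qed
  have w3: "wp_term (n - 1) (j + 1) = W * y * (1 - y\<^sup>2 * q ^ 3) * ((1 - z / y) * (1 - z / y / q) * X)"
  proof -
    have "2 * (j + 1) + 1 = 2 * j + 3" by simp
    then have "q powi (2 * (j + 1) + 1) = y\<^sup>2 * q ^ 3"
      using q_nz by (simp add: y_def pw)
    then show ?thesis unfolding m3[symmetric] wp_term_def Wp by (simp only: mult.assoc)
  qed
  have z1: "q powi (2 * n) = z\<^sup>2" "q powi (2 * n - 1) = z\<^sup>2 / q"
    "q powi (2 * n - 2) = z\<^sup>2 / q\<^sup>2" "q powi (n - 1) = z / q"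
    using q_nz by (simp_all add: z_def pw)
  \<comment> \<open>The recurrence with \<open>W * X\<close> removed.\<close>
  have id: "(1 - z\<^sup>2) * (1 - z\<^sup>2 / q) * (1 - y\<^sup>2 * q)
    = (1 + z\<^sup>2 / q\<^sup>2) * ((1 - y\<^sup>2 * q) * ((1 - z / y) * (1 - z * y * q)))
      + z / q * (q / y * (1 - y\<^sup>2 / q) * ((1 - z * y) * (1 - z * y * q))
        + y * (1 - y\<^sup>2 * q ^ 3) * ((1 - z / y) * (1 - z / y / q)))"
    using y0 q_nz by (simp add: divide_simps) algebra
  have "(1 - z\<^sup>2) * (1 - z\<^sup>2 / q) * (W * (1 - y\<^sup>2 * q) * X)
    = W * X * ((1 - z\<^sup>2) * (1 - z\<^sup>2 / q) * (1 - y\<^sup>2 * q))"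
    by (simp add: mult_ac)
  also have "\<dots> = (1 + z\<^sup>2 / q\<^sup>2) * (W * (1 - y\<^sup>2 * q) * ((1 - z / y) * (1 - z * y * q) * X))
    + z / q * (W * q / y * (1 - y\<^sup>2 / q) * ((1 - z * y) * (1 - z * y * q) * X)
      + W * y * (1 - y\<^sup>2 * q ^ 3) * ((1 - z / y) * (1 - z / y / q) * X))"
    unfolding id by (simp only: distrib_left mult_ac times_divide_eq_left times_divide_eq_right)
  finally show ?thesis unfolding w0 w1 w2 w3 z1 .
qed

section \<open>Evaluation of the bilateral sum without u and v\<close>

text \<open>The reflection of \<open>wp_term_antisym\<close> carries the class 0 modulo 4 to the
  class 3, and on \<open>s\<close> it acts as \<open>s \<mapsto> - s\<close>, which preserves the
  range.\<close>

lemma wp_term_sum_neg: "(\<Sum>s\<in>{-M..M}. wp_term n (4 * s - 1)) = - (\<Sum>s\<in>{-M..M}. wp_term n (4 * s))"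
proof -
  have "(\<Sum>s\<in>{-M..M}. wp_term n (4 * s - 1)) = (\<Sum>s\<in>{-M..M}. wp_term n (4 * (- s) - 1))"
    by (rule sum.reindex_bij_witness[where i = uminus and j = uminus]) auto
  also have "\<dots> = - (\<Sum>s\<in>{-M..M}. wp_term n (4 * s))"
    using wp_term_antisym[of n "4 * _"] by (simp add: sum_negf)
  finally show ?thesis .
qed

text \<open>The same reflection exchanges the classes 1 and 2. The four class sums are thereby
  reduced to two.\<close>

lemma wp_term_sum_neg':
  assumes "0 \<le> n" "n \<le> M"
  shows "(\<Sum>s\<in>{-M..M}. wp_term n (4 * s + 2)) = - (\<Sum>s\<in>{-M..M}. wp_term n (4 * s + 1))"
proof -
  \<comment> \<open>Here the reflection acts as \<open>s \<mapsto> - s - 1\<close>, which does not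
    preserve \<open>{-M..M}\<close>. The range is enlarged by \<open>s = - M - 1\<close>, where the
    bounds on \<open>n\<close> put the index outside the support.\<close>
  have ext: "(\<Sum>s\<in>{-M..M}. wp_term n (4 * s + c)) = (\<Sum>s\<in>{-M-1..M}. wp_term n (4 * s + c))"
    if "c \<in> {1, 2}" for c
  proof (rule sum.mono_neutral_left)
    show "\<forall>i\<in>{-M-1..M} - {-M..M}. wp_term n (4 * i + c) = 0"
      using assms that by (auto intro!: wp_term_support)
  qed auto
  have "(\<Sum>s\<in>{-M-1..M}. wp_term n (4 * s + 2)) = (\<Sum>s\<in>{-M-1..M}. wp_term n (4 * (- s - 1) + 2))"
    by (rule sum.reindex_bij_witness[where i = "\<lambda>s. - s - 1" and j = "\<lambda>s. - s - 1"]) auto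
  also have "\<dots> = - (\<Sum>s\<in>{-M-1..M}. wp_term n (4 * s + 1))"
  proof -
    have "wp_term n (4 * (- s - 1) + 2) = - wp_term n (4 * s + 1)" for s
      using wp_term_antisym[of n "4 * s + 1"] by (simp add: algebra_simps)
    then show ?thesis by (simp add: sum_negf)
  qed
  finally show ?thesis using ext[of 1] ext[of 2] by simp
qed

lemma rq_0 [simp]: "rq 0 = 1" and rq_1: "rq 1 = 1 / (1 - q)"
  by (simp_all add: rq_def qpoch_def)

lemma wp_term_sum_0:
  assumes "0 \<le> M"
  shows "(\<Sum>s\<in>{-M..M}. wp_term 0 (4 * s)) = 1" "(\<Sum>s\<in>{-M..M}. wp_term 0 (4 * s + 1)) = 0"
proof -
  have "(\<Sum>s\<in>{-M..M}. wp_term 0 (4 * s)) = (\<Sum>s\<in>{0}. wp_term 0 (4 * s))"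
    by (rule sum.mono_neutral_right) (use assms in \<open>auto intro!: wp_term_support\<close>)
  also have "\<dots> = 1"
    using pow_neq_1[of 1] by (simp add: wp_term_def rq_1)
  finally show "(\<Sum>s\<in>{-M..M}. wp_term 0 (4 * s)) = 1" .
  show "(\<Sum>s\<in>{-M..M}. wp_term 0 (4 * s + 1)) = 0"
    by (rule sum.neutral) (auto intro!: wp_term_support)
qed

text \<open>The neighbours of \<open>4 * s\<close> lie in the classes 3 and 1, contributing
  \<open>- A\<close> and \<open>B\<close>; those of \<open>4 * s + 1\<close> lie in the classes 0
  and 2, contributing \<open>A\<close> and \<open>- B\<close>. So summing \<open>wp_term_rec\<close>
  gives a closed system for \<open>A\<close> and \<open>B\<close>.\<close>

lemma wp_term_sums_rec:
  fixes n :: nat and M :: int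
  assumes "int n + 1 \<le> M"
  defines "A \<equiv> \<lambda>n. \<Sum>s\<in>{-M..M}. wp_term n (4 * s)"
    and "B \<equiv> \<lambda>n. \<Sum>s\<in>{-M..M}. wp_term n (4 * s + 1)"
  shows "(1 - q ^ (2 * n + 2)) * (1 - q ^ (2 * n + 1)) * A (int n + 1)
      = (1 + q ^ (2 * n)) * A n + q ^ n * (B n - A n)"
    and "(1 - q ^ (2 * n + 2)) * (1 - q ^ (2 * n + 1)) * B (int n + 1)
      = (1 + q ^ (2 * n)) * B n + q ^ n * (A n - B n)"
proof -
  have e: "q powi (2 * (int n + 1)) = q ^ (2 * n + 2)"
    "q powi (2 * (int n + 1) - 1) = q ^ (2 * n + 1)"
    "q powi (2 * (int n + 1) - 2) = q ^ (2 * n)"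
    "q powi (int n + 1 - 1) = q ^ n"
    by (simp_all add: power_int_def nat_add_distrib nat_mult_distrib)
  have rec: "(1 - q ^ (2 * n + 2)) * (1 - q ^ (2 * n + 1)) * wp_term (int n + 1) j
      = (1 + q ^ (2 * n)) * wp_term n j + q ^ n * (wp_term n (j - 1) + wp_term n (j + 1))" for j
    using wp_term_rec[of "int n + 1" j] unfolding e by simp
  show "(1 - q ^ (2 * n + 2)) * (1 - q ^ (2 * n + 1)) * A (int n + 1)
      = (1 + q ^ (2 * n)) * A n + q ^ n * (B n - A n)"
    unfolding A_def B_def sum_distrib_left rec sum.distrib
    by (simp add: wp_term_sum_neg sum.distrib flip: sum_distrib_left)
  have "(1 - q ^ (2 * n + 2)) * (1 - q ^ (2 * n + 1)) * B (int n + 1)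
    = (\<Sum>s\<in>{-M..M}. (1 + q ^ (2 * n)) * wp_term n (4 * s + 1)
        + q ^ n * (wp_term n (4 * s) + wp_term n (4 * s + 2)))"
    unfolding B_def sum_distrib_left rec by (simp add: add.assoc)
  also have "\<dots> = (1 + q ^ (2 * n)) * B n + q ^ n * (A n - B n)"
    using assms(1)
    by (simp add: A_def B_def wp_term_sum_neg' sum.distrib flip: sum_distrib_left)
  finally show "(1 - q ^ (2 * n + 2)) * (1 - q ^ (2 * n + 1)) * B (int n + 1)
      = (1 + q ^ (2 * n)) * B n + q ^ n * (A n - B n)" .
qed

lemma pow_fac_nz: "k \<ge> 1 \<Longrightarrow> 1 - q ^ k \<noteq> 0"
  using pow_neq_1 by simp

text \<open>At index 0 the two sums are 1 and 0, but one step of the recurrence gives both the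
  right-hand side \<open>A + B\<close>, so they agree from index 1 on. The coupling term
  \<open>B - A\<close> then vanishes and the recurrence is a plain product formula. The induction
  starts at index 1 and carries both sums to keep this equality.\<close>

lemma wp_term_sum_eval:
  fixes n :: nat and M :: int
  assumes "int n + 1 \<le> M"
  shows "(\<Sum>s\<in>{-M..M}. wp_term (int n + 1) (4 * s)) = qpoch (- (q\<^sup>2)) (q\<^sup>2) n / qpoch q q (2 * n + 2)
    \<and> (\<Sum>s\<in>{-M..M}. wp_term (int n + 1) (4 * s + 1)) = qpoch (- (q\<^sup>2)) (q\<^sup>2) n / qpoch q q (2 * n + 2)"
  using assms
proof (induction n)
  case 0
  have q2: "qpoch q q (Suc (Suc 0)) = (1 - q\<^sup>2) * (1 - q)"
    by (simp add: qpoch_Suc qpoch_def[of _ _ 0] power2_eq_square)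
  have nz: "1 - q \<noteq> 0" "1 - q\<^sup>2 \<noteq> 0"
    using pow_fac_nz[of 1] pow_fac_nz[of 2] by simp_all
  have "0 \<le> M" using 0 by simp
  then have "(1 - q\<^sup>2) * (1 - q) * (\<Sum>s\<in>{-M..M}. wp_term 1 (4 * s)) = 1"
    "(1 - q\<^sup>2) * (1 - q) * (\<Sum>s\<in>{-M..M}. wp_term 1 (4 * s + 1)) = 1"
    using wp_term_sums_rec[of 0 M] 0 wp_term_sum_0[of M] by (simp_all add: power2_eq_square)
  with nz have "(\<Sum>s\<in>{-M..M}. wp_term 1 (4 * s)) = 1 / ((1 - q\<^sup>2) * (1 - q))"
    "(\<Sum>s\<in>{-M..M}. wp_term 1 (4 * s + 1)) = 1 / ((1 - q\<^sup>2) * (1 - q))"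
    by (simp_all add: eq_divide_eq mult.commute)
  then show ?case
    using q2 by (simp add: qpoch_def[of _ _ 0])
next
  case (Suc n)
  define P where "P = qpoch (- (q\<^sup>2)) (q\<^sup>2) n / qpoch q q (2 * n + 2)"
  define a where "a = (1 - q ^ (2 * Suc n + 2)) * (1 - q ^ (2 * Suc n + 1))"
  have a0: "a \<noteq> 0" unfolding a_def using pow_fac_nz[of "2 * Suc n + 2"] pow_fac_nz[of "2 * Suc n + 1"]
    by simp
  have IH: "(\<Sum>s\<in>{-M..M}. wp_term (int (Suc n)) (4 * s)) = P"
    "(\<Sum>s\<in>{-M..M}. wp_term (int (Suc n)) (4 * s + 1)) = P"
    using Suc by (simp_all add: P_def add.commute)
  have S: "a * (\<Sum>s\<in>{-M..M}. wp_term (int (Suc n) + 1) (4 * s)) = (1 + q ^ (2 * Suc n)) * P"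
    "a * (\<Sum>s\<in>{-M..M}. wp_term (int (Suc n) + 1) (4 * s + 1)) = (1 + q ^ (2 * Suc n)) * P"
    using wp_term_sums_rec[of "Suc n" M] Suc.prems unfolding IH a_def by simp_all
  have "2 * Suc n + 2 = Suc (Suc (2 * n + 2))" by simp
  then have d: "qpoch q q (2 * Suc n + 2) = qpoch q q (2 * n + 2) * a"
    by (simp only: qpoch_Suc a_def) (simp add: algebra_simps)
  have "qpoch (- (q\<^sup>2)) (q\<^sup>2) (Suc n) = qpoch (- (q\<^sup>2)) (q\<^sup>2) n * (1 + q ^ (2 * Suc n))"
    by (simp add: qpoch_Suc power2_eq_square power_mult power_mult_distrib)
  then have "qpoch (- (q\<^sup>2)) (q\<^sup>2) (Suc n) / qpoch q q (2 * Suc n + 2) = (1 + q ^ (2 * Suc n)) * P / a"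
    unfolding d P_def by simp
  moreover have "X = (1 + q ^ (2 * Suc n)) * P / a" if "a * X = (1 + q ^ (2 * Suc n)) * P" for X
    using that a0 by (simp add: eq_divide_eq mult.commute)
  ultimately show ?case using S by metis
qed


text \<open>The first recurrence after its coupling term has dropped out. The bound
  \<open>1 \<le> n\<close> matters, since the two class sums differ at index 0.\<close>

lemma wp_term_sum_ratio:
  fixes n :: nat and M :: int
  assumes "1 \<le> n" "int n + 1 \<le> M"
  shows "(1 - q ^ (2 * n + 2)) * (1 - q ^ (2 * n + 1)) * (\<Sum>s\<in>{-M..M}. wp_term (int n + 1) (4 * s))
    = (1 + q ^ (2 * n)) * (\<Sum>s\<in>{-M..M}. wp_term n (4 * s))"
proof -
  obtain m where n: "n = Suc m" using assms(1) by (cases n) auto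
  have "(\<Sum>s\<in>{-M..M}. wp_term n (4 * s + 1)) = (\<Sum>s\<in>{-M..M}. wp_term n (4 * s))"
    using wp_term_sum_eval[of m M] assms(2) unfolding n by (simp add: add.commute)
  then show ?thesis using wp_term_sums_rec(1)[OF assms(2)] by simp
qed

section \<open>Moments of the bilateral sum and their match with K\<close>

definition zsum :: "int \<Rightarrow> complex" where
  "zsum s = q powi (- (4 * s)) + q powi (4 * s + 1)"

definition moment :: "nat \<Rightarrow> int \<Rightarrow> int \<Rightarrow> complex" where
  "moment k M n = (\<Sum>s\<in>{-M..M}. zsum s ^ k * wp_term n (4 * s))"

text \<open>Obtained by summing \<open>wp_term_lower\<close>: the order of a moment is raised at the
  price of one value at a smaller index.\<close>

lemma moment_Suc:
  "q ^ (n + 1) * moment (Suc k) M (int n + 1) = (1 + q ^ (2 * n + 3)) * moment k M (int n + 1) - moment k M n"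
proof -
  have e: "q powi (2 * (int n + 1) + 1) = q ^ (2 * n + 3)" "q powi (int n + 1) = q ^ (n + 1)"
    by (simp_all add: power_int_def nat_add_distrib nat_mult_distrib eval_nat_numeral)
  have "wp_term n (4 * s) = (1 + q ^ (2 * n + 3) - q ^ (n + 1) * zsum s) * wp_term (int n + 1) (4 * s)" for s
    using wp_term_lower[of "int n + 1" "4 * s"] unfolding e zsum_def by simp
  then have "moment k M n = (\<Sum>s\<in>{-M..M}. (1 + q ^ (2 * n + 3)) * (zsum s ^ k * wp_term (int n + 1) (4 * s))
      - q ^ (n + 1) * (zsum s ^ Suc k * wp_term (int n + 1) (4 * s)))"
    unfolding moment_def by (intro sum.cong) (simp_all add: left_diff_distrib right_diff_distrib mult_ac)
  then show ?thesis
    unfolding moment_def by (simp add: sum_subtractf flip: sum_distrib_left)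
qed

lemma one_plus_pow_nz: "k \<ge> 1 \<Longrightarrow> 1 + q ^ k \<noteq> 0"
proof
  assume "k \<ge> 1" "1 + q ^ k = 0"
  then have "q ^ k = - 1" by (simp add: eq_neg_iff_add_eq_0 add.commute)
  then have "q ^ (2 * k) = 1" by (simp add: power_mult mult.commute[of 2])
  with pow_neq_1[of "2 * k"] \<open>k \<ge> 1\<close> show False by simp
qed

text \<open>\<open>moment_Suc\<close> with order 0 brings in the zeroth moment at \<open>n\<close>,
  which \<open>wp_term_sum_ratio\<close> removes. The product on the right comes from \<open>(1 +
  w^2) * (1 + w^2 * q^3) - (1 - w^2 * q^2) * (1 - w^2 * q) = w^2 * (1 + q) * (1 +
  q^2)\<close>.\<close>

lemma first_moment:
  assumes "1 \<le> n" "int n + 1 \<le> M"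
  shows "q * (1 + q ^ (2 * n)) * moment 1 M (int n + 1) = (1 + q) * (1 + q\<^sup>2) * q ^ n * moment 0 M (int n + 1)"
proof -
  define w where "w = q ^ n"
  have w0: "w \<noteq> 0" using q_nz by (simp add: w_def)
  have e: "q ^ (2 * n) = w\<^sup>2" "q ^ (2 * n + 2) = w\<^sup>2 * q\<^sup>2" "q ^ (2 * n + 1) = w\<^sup>2 * q"
    "q ^ (2 * n + 3) = w\<^sup>2 * q ^ 3" "q ^ (n + 1) = w * q"
    by (simp_all add: w_def power_add power_mult mult.commute[of 2]) (simp_all add: power2_eq_square)
  have r: "(1 - w\<^sup>2 * q\<^sup>2) * (1 - w\<^sup>2 * q) * moment 0 M (int n + 1) = (1 + w\<^sup>2) * moment 0 M n"
    using wp_term_sum_ratio[OF assms] unfolding e by (simp add: moment_def)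
  have s: "w * q * moment 1 M (int n + 1) = (1 + w\<^sup>2 * q ^ 3) * moment 0 M (int n + 1) - moment 0 M n"
    using moment_Suc[of n 0 M] unfolding e by simp
  have "w * (q * (1 + w\<^sup>2) * moment 1 M (int n + 1)) = w * ((1 + q) * (1 + q\<^sup>2) * w * moment 0 M (int n + 1))"
    using r s by algebra
  then show ?thesis unfolding e w_def[symmetric] using w0 by simp
qed

text \<open>After clearing denominators, the coefficients of \<open>u * v\<close>, \<open>(u + v) * (q + u * v)\<close> and
  \<open>(u\<^sup>2 + q) * (v\<^sup>2 + q)\<close> on the left are, up to sign, the moments of order 2, 1 and 0; the
  numerator of \<open>K\<close> is grouped in the same way.\<close>
lemma moments_eq_K6:
  fixes u v :: complex
  assumes n: "3 \<le> n" "int n \<le> M"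
    and nz: "u \<noteq> 0" "v \<noteq> 0" "1 - u \<noteq> 0" "q - u \<noteq> 0" "1 - v \<noteq> 0" "q - v \<noteq> 0"
  shows "moment 2 M n - (u + q / u + (v + q / v)) * moment 1 M n + (u + q / u) * (v + q / v) * moment 0 M n
    = (1 - u) * (1 - v) * (1 - q / u) * (1 - q / v) * K6 q u v n * moment 0 M n"
proof -
  \<comment> \<open>The second moment at \<open>n\<close> needs the first moments at
    \<open>n\<close> and \<open>n - 1\<close>. The latter comes from \<open>first_moment\<close> at
    \<open>m = n - 2\<close>, which must be at least 1; this is where \<open>3 \<le> n\<close>
    enters.\<close>
  obtain m where m: "n = m + 2" "m \<ge> 1" using n(1) that[of "n - 2"] by simp
  define w where "w = q ^ m"
  have w0: "w \<noteq> 0" using q_nz by (simp add: w_def)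
  define T0 T1 T2 where T: "T0 = moment 0 M n" "T1 = moment 1 M n" "T2 = moment 2 M n"
  define E where "E = (1 + q) * (1 + q\<^sup>2)"
  have a1: "1 + w\<^sup>2 \<noteq> 0" using one_plus_pow_nz[of "2 * m"] m(2) by (simp add: w_def power_mult mult.commute)
  have e22: "q ^ (2 * m + 2) = q\<^sup>2 * w\<^sup>2"
    by (simp only: w_def power_add power_mult mult.commute[of 2 m] mult.commute[of "q\<^sup>2"])
  have a2: "1 + q\<^sup>2 * w\<^sup>2 \<noteq> 0"
    using one_plus_pow_nz[of "2 * m + 2"] e22 by simp
  have a3: "1 - w\<^sup>2 \<noteq> 0" using pow_fac_nz[of "2 * m"] m(2) by (simp add: w_def power_mult mult.commute)
  have a4: "1 - q\<^sup>2 * w\<^sup>2 \<noteq> 0"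
    using pow_fac_nz[of "2 * m + 2"] e22 by simp
  have ew: "q ^ (2 * m) = w\<^sup>2" "q ^ Suc m = q * w" "q ^ (2 * Suc m) = q\<^sup>2 * w\<^sup>2"
    "q ^ (2 * Suc m + 2) = q ^ 4 * w\<^sup>2" "q ^ (2 * Suc m + 1) = q ^ 3 * w\<^sup>2"
    "q ^ (Suc m + 1) = q\<^sup>2 * w" "q ^ (2 * Suc m + 3) = q ^ 5 * w\<^sup>2"
    by (simp_all add: w_def power_add power_mult mult.commute[of 2]) (simp_all add: eval_nat_numeral)
  have nn: "int (Suc m) + 1 = int n" "int m + 1 = int (Suc m)" using m(1) by simp_all
  define U0 U1 where U: "U0 = moment 0 M (Suc m)" "U1 = moment 1 M (Suc m)"
  have r0: "(1 - q ^ 4 * w\<^sup>2) * (1 - q ^ 3 * w\<^sup>2) * T0 = (1 + q\<^sup>2 * w\<^sup>2) * U0"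
    using wp_term_sum_ratio[of "Suc m" M] m n unfolding ew nn by (simp add: T U moment_def)
  have r1: "q * (1 + q\<^sup>2 * w\<^sup>2) * T1 = E * (q * w) * T0"
    using first_moment[of "Suc m" M] m n unfolding ew nn by (simp add: T E_def)
  have r2: "q * (1 + w\<^sup>2) * U1 = E * w * U0"
    using first_moment[of m M] m n unfolding ew nn by (simp add: U E_def flip: w_def)
  have r3: "q\<^sup>2 * w * T2 = (1 + q ^ 5 * w\<^sup>2) * T1 - U1"
    using moment_Suc[of "Suc m" 1 M] unfolding ew nn by (simp add: T U numeral_2_eq_2)
  \<comment> \<open>\<open>\<rho>1\<close> and \<open>\<rho>2\<close> are the first and second
    moments divided by the zeroth. The second is read off from \<open>r3\<close> after
    \<open>r1\<close>, \<open>r2\<close> and \<open>r0\<close> have expressed everything through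
    \<open>T0\<close>.\<close>
  define \<rho>1 where "\<rho>1 = E * w / (1 + q\<^sup>2 * w\<^sup>2)"
  define \<rho>2 where "\<rho>2 = E * (q * (1 + q ^ 5 * w\<^sup>2) * (1 + w\<^sup>2) - (1 - q ^ 4 * w\<^sup>2) * (1 - q ^ 3 * w\<^sup>2))
    / (q ^ 3 * (1 + w\<^sup>2) * (1 + q\<^sup>2 * w\<^sup>2))"
  have T1: "T1 = \<rho>1 * T0"
  proof -
    have "q * ((1 + q\<^sup>2 * w\<^sup>2) * T1) = q * (E * w * T0)"
      using r1 by (simp only: mult_ac)
    then have "(1 + q\<^sup>2 * w\<^sup>2) * T1 = E * w * T0" using q_nz by simp
    then show ?thesis using a2 by (simp add: \<rho>1_def eq_divide_eq mult_ac)
  qed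
  have T2: "T2 = \<rho>2 * T0"
  proof -
    have "(q\<^sup>2 * w) * (q * (1 + w\<^sup>2) * (1 + q\<^sup>2 * w\<^sup>2) * T2)
      = w * (E * (q * (1 + q ^ 5 * w\<^sup>2) * (1 + w\<^sup>2) - (1 - q ^ 4 * w\<^sup>2) * (1 - q ^ 3 * w\<^sup>2)) * T0)"
      (is "?L = ?R")
    proof -
      have "?L = q * (1 + w\<^sup>2) * (1 + q\<^sup>2 * w\<^sup>2) * (q\<^sup>2 * w * T2)"
        by (simp only: mult_ac)
      also have "\<dots> = (1 + w\<^sup>2) * (1 + q ^ 5 * w\<^sup>2) * (q * (1 + q\<^sup>2 * w\<^sup>2) * T1)
          - (1 + q\<^sup>2 * w\<^sup>2) * (q * (1 + w\<^sup>2) * U1)"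
        unfolding r3 by (simp only: right_diff_distrib mult_ac)
      also have "\<dots> = (1 + w\<^sup>2) * (1 + q ^ 5 * w\<^sup>2) * (E * (q * w) * T0)
          - E * w * ((1 + q\<^sup>2 * w\<^sup>2) * U0)"
        unfolding r1 r2 by (simp only: mult_ac)
      also have "\<dots> = ?R"
        unfolding r0[symmetric] by (simp only: right_diff_distrib left_diff_distrib mult_ac)
      finally show ?thesis .
    qed
    then have "q ^ 3 * (1 + w\<^sup>2) * (1 + q\<^sup>2 * w\<^sup>2) * T2
      = E * (q * (1 + q ^ 5 * w\<^sup>2) * (1 + w\<^sup>2) - (1 - q ^ 4 * w\<^sup>2) * (1 - q ^ 3 * w\<^sup>2)) * T0"
      using w0 by (simp add: power2_eq_square power3_eq_cube mult_ac)
    then show ?thesis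
      using a1 a2 q_nz unfolding \<rho>2_def by (simp add: eq_divide_eq mult_ac)
  qed
  have pw: "q powi (- int n) = 1 / (q\<^sup>2 * w)" "q powi (1 - int n) = 1 / (q * w)"
    "q powi (2 - int n) = 1 / w" "q powi (3 - int n) = q / w"
    using q_nz by (simp_all add: m(1) w_def power_int_minus power_int_diff power_int_add
        power2_eq_square power3_eq_cube field_simps)
  \<comment> \<open>Elementary symmetric functions of the geometric progression with first term
    \<open>1 / (q^2 * w)\<close> and ratio \<open>q\<close>, the four arguments of
    \<open>K\<close>.\<close>
  define \<sigma>1 \<sigma>2 \<sigma>3 \<sigma>4 where \<sigma>: "\<sigma>1 = E / (q\<^sup>2 * w)" "\<sigma>2 = (1 + q + 2 * q\<^sup>2 + q ^ 3 + q ^ 4) / (q ^ 3 * w\<^sup>2)"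
    "\<sigma>3 = E / (q ^ 3 * w ^ 3)" "\<sigma>4 = 1 / (q\<^sup>2 * w ^ 4)"
  have s1: "1 / (q\<^sup>2 * w) + 1 / (q * w) + 1 / w + q / w = \<sigma>1"
    using q_nz w0 unfolding \<sigma> E_def by (simp add: field_simps power2_eq_square)
  have s2: "1 / (q\<^sup>2 * w) * (1 / (q * w)) + 1 / (q\<^sup>2 * w) * (1 / w) + 1 / (q\<^sup>2 * w) * (q / w)
      + 1 / (q * w) * (1 / w) + 1 / (q * w) * (q / w) + 1 / w * (q / w) = \<sigma>2"
    using q_nz w0 unfolding \<sigma> by (simp add: divide_simps) algebra
  have s3: "1 / (q\<^sup>2 * w) * (1 / (q * w)) * (1 / w) + 1 / (q\<^sup>2 * w) * (1 / (q * w)) * (q / w)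
      + 1 / (q\<^sup>2 * w) * (1 / w) * (q / w) + 1 / (q * w) * (1 / w) * (q / w) = \<sigma>3"
    using q_nz w0 unfolding \<sigma> E_def by (simp add: divide_simps) algebra
  have s4: "1 / (q\<^sup>2 * w) * (1 / (q * w)) * (1 / w) * (q / w) = \<sigma>4"
    using q_nz w0 unfolding \<sigma> by (simp add: divide_simps) algebra
  \<comment> \<open>The two \<open>\<sigma>4\<close> factors in the denominator of \<open>K\<close>
    for a = q and p = q^4. Their factorizations below show that they are nonzero.\<close>
  define D1 where "D1 = q\<^sup>2 - \<sigma>4"
  define D2 where "D2 = q\<^sup>2 - q ^ 4 * \<sigma>4"
  have D1: "D1 = - (1 - q\<^sup>2 * w\<^sup>2) * (1 + q\<^sup>2 * w\<^sup>2) / (q\<^sup>2 * w ^ 4)"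
    using q_nz w0 unfolding D1_def \<sigma> by (simp add: divide_simps) algebra
  have D2: "D2 = - q\<^sup>2 * (1 - w\<^sup>2) * (1 + w\<^sup>2) / w ^ 4"
    using q_nz w0 unfolding D2_def \<sigma> by (simp add: divide_simps) algebra
  have D0: "D1 \<noteq> 0" "D2 \<noteq> 0" using D1 D2 a1 a2 a3 a4 q_nz w0 by auto
  \<comment> \<open>The heart of the match: after division by \<open>D1 * D2\<close>, the u,v-free
    coefficients in the numerator of \<open>K\<close> are exactly the moment ratios, up to
    sign.\<close>
  have c1: "(\<sigma>3 - q * \<sigma>1) * q = - \<rho>1 * D1"
    using q_nz w0 a2 unfolding D1 \<sigma> \<rho>1_def by (simp add: divide_simps) algebra
  have c2: "(\<sigma>3 - q * \<sigma>1) * (q ^ 4 * \<sigma>3 - q * \<sigma>1) * q\<^sup>2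
      + (1 - q ^ 4) * D1 * (q\<^sup>2 - \<sigma>2 * q + \<sigma>4) * q = \<rho>2 * D1 * D2"
    using q_nz w0 a1 a2 unfolding D1 D2 \<sigma> \<rho>2_def E_def by (simp add: divide_simps) algebra
  have "K6 q u v n = (u * v * (\<sigma>3 - q * \<sigma>1) * (q ^ 4 * \<sigma>3 - q * \<sigma>1) * q\<^sup>2
          + (1 - q ^ 4) * u * v * D1 * (q\<^sup>2 - \<sigma>2 * q + \<sigma>4) * q
          + (u + v) * (q + u * v) * (\<sigma>3 - q * \<sigma>1) * D2 * q
          + (u\<^sup>2 + q) * (v\<^sup>2 + q) * D1 * D2)
         / (D1 * D2 * (1 - u) * (q - u) * (1 - v) * (q - v))"
    using n(1) unfolding K6_def K_def Let_def pw s1 s2 s3 s4 D1_def D2_def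
    by (simp add: mult.commute[of \<sigma>4])
  also have "\<dots> = (u * v * ((\<sigma>3 - q * \<sigma>1) * (q ^ 4 * \<sigma>3 - q * \<sigma>1) * q\<^sup>2
          + (1 - q ^ 4) * D1 * (q\<^sup>2 - \<sigma>2 * q + \<sigma>4) * q)
          + (u + v) * (q + u * v) * ((\<sigma>3 - q * \<sigma>1) * q) * D2
          + (u\<^sup>2 + q) * (v\<^sup>2 + q) * D1 * D2)
         / (D1 * D2 * ((1 - u) * (q - u) * (1 - v) * (q - v)))"
    by (simp only: distrib_left[of u] distrib_left[of v] mult_ac)
  also have "\<dots> = D1 * D2 * (u * v * \<rho>2 - (u + v) * (q + u * v) * \<rho>1 + (u\<^sup>2 + q) * (v\<^sup>2 + q))
         / (D1 * D2 * ((1 - u) * (q - u) * (1 - v) * (q - v)))"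
    unfolding c1 c2 by (simp only: distrib_left[of D1] distrib_left[of D2] right_diff_distrib mult_minus_left
        mult_minus_right mult_ac add_uminus_conv_diff)
  also have "\<dots> = (u * v * \<rho>2 - (u + v) * (q + u * v) * \<rho>1 + (u\<^sup>2 + q) * (v\<^sup>2 + q))
         / ((1 - u) * (q - u) * (1 - v) * (q - v))"
    using D0 by simp
  finally have K: "(1 - u) * (q - u) * (1 - v) * (q - v) * K6 q u v n
    = u * v * \<rho>2 - (u + v) * (q + u * v) * \<rho>1 + (u\<^sup>2 + q) * (v\<^sup>2 + q)"
    using nz by simp
  have "u * v * (moment 2 M n - (u + q / u + (v + q / v)) * moment 1 M n + (u + q / u) * (v + q / v) * moment 0 M n)
    = (u * v * \<rho>2 - (u + v) * (q + u * v) * \<rho>1 + (u\<^sup>2 + q) * (v\<^sup>2 + q)) * T0"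
    using nz(1,2) unfolding T[symmetric] T1 T2 by (simp add: divide_simps) algebra
  also have "\<dots> = u * v * ((1 - u) * (1 - v) * (1 - q / u) * (1 - q / v) * K6 q u v n * moment 0 M n)"
    unfolding K[symmetric] T using nz(1,2) by (simp add: divide_simps) algebra
  finally show ?thesis using nz(1,2) by simp
qed

section \<open>Continuation of G to negative indices and the folded Bailey sum\<close>

text \<open>The telescoped form of \<open>G\<close>, with \<open>q powi (4 * s)\<close> in place of
  \<open>(q ^ 4) ^ r\<close>, so that negative \<open>s\<close> is allowed.\<close>

definition G_int :: "complex \<Rightarrow> complex \<Rightarrow> int \<Rightarrow> complex" where
  "G_int u v s = (1 - u * q powi (4 * s)) * (1 - v * q powi (4 * s))
      * (1 - q powi (4 * s + 1) / u) * (1 - q powi (4 * s + 1) / v)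
    / ((1 - u) * (1 - v) * (1 - q / u) * (1 - q / v))"

text \<open>The weight of \<open>\<alpha> j\<close> is even in \<open>j\<close> once written with
  \<open>rq\<close>. So the two parts of \<open>\<alpha> (4 * r)\<close> sit at \<open>s = r\<close>
  and \<open>s = - r\<close>, while \<open>\<alpha> (4 * r - 1)\<close> sits at
  \<open>s = - r\<close>, where \<open>4 * s + 1 = - (4 * r - 1)\<close>.\<close>

lemma bailey_sum_fold:
  assumes "\<alpha> 0 = 1" "\<And>r. \<alpha> (4 * r + 2) = 0"
    and "\<And>r. r \<ge> 1 \<Longrightarrow> \<alpha> (4 * r) = g (int r) + g (- int r)"
    and "\<And>r. \<alpha> (4 * r + 1) = - g' (int r)"
    and "\<And>r. r \<ge> 1 \<Longrightarrow> \<alpha> (4 * r - 1) = - g' (- int r)"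
    and "g 0 = 1"
  shows "(\<Sum>j\<le>n. \<alpha> j / (qpoch q q (n - j) * qpoch q q (n + j)))
    = (\<Sum>s\<in>{- int n..int n}. g s * rq (int n - 4 * s) * rq (int n + 4 * s)
        - g' s * rq (int n - 4 * s - 1) * rq (int n + 4 * s + 1))"
proof -
  define a where "a j = \<alpha> j * rq (int n - int j) * rq (int n + int j)" for j
  define h where "h s = g s * rq (int n - 4 * s) * rq (int n + 4 * s)
        - g' s * rq (int n - 4 * s - 1) * rq (int n + 4 * s + 1)" for s
  have "(\<Sum>j\<le>n. \<alpha> j / (qpoch q q (n - j) * qpoch q q (n + j))) = (\<Sum>j\<le>n. a j)"
    by (intro sum.cong) (auto simp: a_def rq_def nat_add_distrib nat_diff_distrib)
  \<comment> \<open>The added indices exceed \<open>n\<close> and contribute nothing because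
    \<open>rq\<close> is zero at negative arguments; now the sum consists of complete
    blocks.\<close>
  also have "\<dots> = (\<Sum>j\<le>4 * n + 1. a j)"
    by (rule sum.mono_neutral_left) (auto simp: a_def rq_def)
  also have "\<dots> = (\<Sum>s\<in>{- int n..int n}. h s)"
  proof (rule sum_fold_integers)
    show "h 0 = a 0 + a 1"
      using assms(1,6) assms(4)[of 0] by (simp add: h_def a_def)
    fix r :: nat assume r: "r \<ge> 1"
    obtain k where k: "r = Suc k" using r by (cases r) auto
    have z: "a (4 * r - 2) = 0" using assms(2)[of k] by (simp add: a_def k)
    have i: "int (4 * r - 1) = 4 * int r - 1" using r by (simp add: of_nat_diff)
    show "h (int r) + h (- int r) = a (4 * r - 2) + a (4 * r - 1) + a (4 * r) + a (4 * r + 1)"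
      unfolding z unfolding a_def i h_def assms(3)[OF r] assms(4) assms(5)[OF r]
      by (simp add: algebra_simps)
  qed
  finally show ?thesis by (simp add: h_def)
qed

text \<open>Multiplying out \<open>G_int\<close>: with \<open>y = q powi (4 * s)\<close> one has
  \<open>(1 - u * y) * (1 - q * y / u) = y * (zsum s - (u + q / u))\<close>.\<close>
lemma G_int_wp_term:
  assumes "u \<noteq> 0" "v \<noteq> 0"
  shows "G_int u v s * q powi (8 * s\<^sup>2 - 10 * s) * (1 - q powi (8 * s + 1)) * rq (n - 4 * s) * rq (n + 4 * s + 1)
    = (zsum s - (u + q / u)) * (zsum s - (v + q / v)) * wp_term n (4 * s)
      / ((1 - u) * (1 - v) * (1 - q / u) * (1 - q / v))"
proof -
  define y where "y = q powi (4 * s)"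
  have y0: "y \<noteq> 0" using q_nz by (simp add: y_def)
  have z: "zsum s = 1 / y + q * y" "q powi (4 * s + 1) = q * y"
    using q_nz by (simp_all add: zsum_def y_def power_int_minus power_int_add inverse_eq_divide)
  have f: "(1 - t * y) * (1 - q * y / t) = y * (1 / y + q * y - (t + q / t))" if "t \<noteq> 0" for t
    using that y0 by (simp add: field_simps)
  have "G_int u v s = ((1 - u * y) * (1 - q * y / u)) * ((1 - v * y) * (1 - q * y / v))
      / ((1 - u) * (1 - v) * (1 - q / u) * (1 - q / v))"
    unfolding G_int_def z y_def[symmetric] by (simp only: mult_ac)
  then have g: "G_int u v s = y\<^sup>2 * ((zsum s - (u + q / u)) * (zsum s - (v + q / v)))
      / ((1 - u) * (1 - v) * (1 - q / u) * (1 - q / v))"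
    unfolding f[OF assms(1)] f[OF assms(2)] z power2_eq_square by (simp only: mult_ac)
  have "y\<^sup>2 = q powi (8 * s)"
    using power_int_mult[of q "4 * s" 2] by (simp add: y_def)
  then have "y\<^sup>2 * q powi (8 * s\<^sup>2 - 10 * s) = q powi (8 * s\<^sup>2 - 2 * s)"
    using q_nz by (simp flip: power_int_add)
  then have w: "wp_term n (4 * s) = y\<^sup>2 * q powi (8 * s\<^sup>2 - 10 * s) * (1 - q powi (8 * s + 1)) * rq (n - 4 * s) * rq (n + 4 * s + 1)"
    unfolding wp_term_def triangular_4 by simp
  show ?thesis unfolding g w by (simp only: times_divide_eq_left times_divide_eq_right mult_ac)
qed

text \<open>Both reduce to \<open>rq (n - j) * rq (n + j + 1)\<close> by \<open>rq_pred\<close>. The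
  two ways of pairing an even with an odd summand give the same very-well-poised factor up to
  \<open>q powi (n - j)\<close>; this is the source of the extra \<open>q ^ n\<close> in the second
  pair.\<close>

lemma rq_mix:
  "rq (n - j) * rq (n + j) - q powi (2 * j + 1) * rq (n - j - 1) * rq (n + j + 1)
    = (1 - q powi (2 * j + 1)) * rq (n - j) * rq (n + j + 1)"
  "rq (n - j) * rq (n + j) - rq (n - j - 1) * rq (n + j + 1)
    = q powi (n - j) * (1 - q powi (2 * j + 1)) * rq (n - j) * rq (n + j + 1)"
proof -
  have a: "rq (n + j) = (1 - q powi (n + j + 1)) * rq (n + j + 1)"
    using rq_pred[of "n + j + 1"] by simp
  have b: "rq (n - j - 1) = (1 - q powi (n - j)) * rq (n - j)"
    using rq_pred[of "n - j"] by simp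
  have c: "q powi (n + j + 1) = q powi (n - j) * q powi (2 * j + 1)"
    using q_nz by (simp add: add_ac flip: power_int_add)
  show "rq (n - j) * rq (n + j) - q powi (2 * j + 1) * rq (n - j - 1) * rq (n + j + 1)
    = (1 - q powi (2 * j + 1)) * rq (n - j) * rq (n + j + 1)"
    unfolding a b c by (simp only: algebra_simps) simp
  show "rq (n - j) * rq (n + j) - rq (n - j - 1) * rq (n + j + 1)
    = q powi (n - j) * (1 - q powi (2 * j + 1)) * rq (n - j) * rq (n + j + 1)"
    unfolding a b c by (simp only: algebra_simps) simp
qed

lemma G_eq_G_int:
  assumes "generic_params q u v"
  shows "G q u v r = G_int u v (int r)"
proof -
  have nz: "qpochs [u, v, q / u, q / v] (q ^ 4) r \<noteq> 0" for r
    using assms by (simp add: generic_params_def)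
  have e: "q powi (4 * int r) = (q ^ 4) ^ r"
    by (simp add: power_int_def nat_mult_distrib power_mult)
  have e': "q powi (4 * int r + 1) = q * (q ^ 4) ^ r"
    using q_nz by (simp add: power_int_add e)
  have s: "q ^ 5 / t = q ^ 4 * (q / t)" for t
    by (simp add: eval_nat_numeral)
  show ?thesis
    unfolding G_def s
    by (subst qpochs_shift_ratio[OF nz]) (use nz[of 1] in \<open>simp_all add: qpochs_def qpoch_def G_int_def e e'\<close>)
qed

lemma H_eq_G_int:
  assumes "generic_params q u v"
  shows "H q u v r = q powi (16 * int r) * G_int u v (- int r)"
proof -
  have nz: "qpochs [u / q, v / q, 1 / u, 1 / v] (q ^ 4) r \<noteq> 0" for r
    using assms by (simp add: generic_params_def)
  have nz': "u \<noteq> 0" "v \<noteq> 0" using assms by (simp_all add: generic_params_def)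
  define y where "y = (q ^ 4) ^ r"
  have y0: "y \<noteq> 0" using q_nz by (simp add: y_def)
  have e: "q powi (4 * - int r) = 1 / y"
    by (simp add: y_def power_int_def nat_mult_distrib power_mult divide_inverse power_inverse)
  have e': "q powi (4 * - int r + 1) = q / y"
    using q_nz power_int_add[of q "4 * - int r" 1] e by simp
  have e'': "q powi (16 * int r) = y ^ 4"
    by (simp add: y_def power_int_def nat_mult_distrib flip: power_mult)
  have s: "q ^ 3 * t = q ^ 4 * (t / q)" "q ^ 4 / t = q ^ 4 * (1 / t)" for t
    using q_nz by (simp_all add: eval_nat_numeral)
  \<comment> \<open>Pairing \<open>t / q\<close> with \<open>1 / t\<close> and pulling the monomial
    out of each factor replaces \<open>y\<close> by \<open>1 / y\<close>. Each pair yields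
    \<open>y^2\<close>, so the pairs for \<open>u\<close> and \<open>v\<close> together give
    \<open>y^4\<close>, the power \<open>q powi (16 * r)\<close>; the powers of \<open>q\<close>
    cancel against \<open>den\<close>.\<close>
  have num: "(1 - t / q * y) * (1 - 1 / t * y) = y\<^sup>2 / q * ((1 - t * (1 / y)) * (1 - q / y / t))"
    if "t \<noteq> 0" for t
    using that q_nz y0 by (simp add: field_simps power2_eq_square)
  have den: "(1 - t / q) * (1 - 1 / t) = 1 / q * ((1 - t) * (1 - q / t))" if "t \<noteq> 0" for t
    using that q_nz by (simp add: field_simps)
  have "H q u v r = (1 - u / q * y) * (1 - v / q * y) * (1 - 1 / u * y) * (1 - 1 / v * y)
      / ((1 - u / q) * (1 - v / q) * (1 - 1 / u) * (1 - 1 / v))"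
    unfolding H_def s y_def
    by (rule qpochs_shift_ratio[OF nz]) (use nz[of 1] in \<open>simp add: qpochs_def qpoch_def\<close>)
  also have "\<dots> = ((1 - u / q * y) * (1 - 1 / u * y)) * ((1 - v / q * y) * (1 - 1 / v * y))
      / (((1 - u / q) * (1 - 1 / u)) * ((1 - v / q) * (1 - 1 / v)))"
    by (simp only: mult_ac)
  also have "\<dots> = (1 / q\<^sup>2 * (y ^ 4 * ((1 - u * (1 / y)) * (1 - v * (1 / y)) * (1 - q / y / u) * (1 - q / y / v))))
     / (1 / q\<^sup>2 * ((1 - u) * (1 - v) * (1 - q / u) * (1 - q / v)))"
    unfolding num[OF nz'(1)] num[OF nz'(2)] den[OF nz'(1)] den[OF nz'(2)]
    by (rule arg_cong2[where f = "(/)"])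
      (simp_all add: power2_eq_square power4_eq_xxxx mult_ac)
  also have "\<dots> = y ^ 4 * ((1 - u * (1 / y)) * (1 - v * (1 / y)) * (1 - q / y / u) * (1 - q / y / v))
     / ((1 - u) * (1 - v) * (1 - q / u) * (1 - q / v))"
    using q_nz by (simp only: mult_divide_mult_cancel_left_if) simp
  finally show ?thesis unfolding G_int_def e e' e'' by simp
qed


text \<open>By \<open>G_int_wp_term\<close> the summand is a quadratic polynomial in
  \<open>zsum s\<close> times \<open>wp_term\<close>, so the sum is the combination of three moments
  handled by \<open>moments_eq_K6\<close>, with \<open>M = n\<close>.\<close>

lemma bailey_sum_eval:
  assumes gen: "generic_params q u v" and n: "3 \<le> n"
  shows "(\<Sum>s\<in>{- int n..int n}. G_int u v s * q powi (8 * s\<^sup>2 - 10 * s) * (1 - q powi (8 * s + 1))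
      * rq (int n - 4 * s) * rq (int n + 4 * s + 1))
    = K6 q u v n * (qpoch (- (q\<^sup>2)) (q\<^sup>2) (n - 1) / qpoch q q (2 * n))"
proof -
  have nz: "u \<noteq> 0" "v \<noteq> 0" using gen by (simp_all add: generic_params_def)
  define D where "D = (1 - u) * (1 - v) * (1 - q / u) * (1 - q / v)"
  have "qpochs [u, v, q / u, q / v] (q ^ 4) 1 \<noteq> 0"
    using gen unfolding generic_params_def by blast
  then have nz': "1 - u \<noteq> 0" "1 - v \<noteq> 0" "1 - q / u \<noteq> 0" "1 - q / v \<noteq> 0"
    by (auto simp: qpochs_def qpoch_def)
  then have D0: "D \<noteq> 0" by (simp add: D_def)
  have nz'': "q - u \<noteq> 0" "q - v \<noteq> 0" using nz' nz by auto
  have "(\<Sum>s\<in>{- int n..int n}. G_int u v s * q powi (8 * s\<^sup>2 - 10 * s) * (1 - q powi (8 * s + 1))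
      * rq (int n - 4 * s) * rq (int n + 4 * s + 1))
    = (\<Sum>s\<in>{- int n..int n}. (zsum s - (u + q / u)) * (zsum s - (v + q / v)) * wp_term n (4 * s)) / D"
    unfolding G_int_wp_term[OF nz] D_def sum_divide_distrib ..
  also have "(\<Sum>s\<in>{- int n..int n}. (zsum s - (u + q / u)) * (zsum s - (v + q / v)) * wp_term n (4 * s))
    = moment 2 (int n) n - (u + q / u + (v + q / v)) * moment 1 (int n) n
      + (u + q / u) * (v + q / v) * moment 0 (int n) n"
    unfolding moment_def sum_distrib_left sum.distrib[symmetric] sum_subtractf[symmetric]
  proof (intro sum.cong refl)
    fix s
    have "(z - A) * (z - B) * x = z\<^sup>2 * x - (A + B) * (z ^ 1 * x) + A * B * (z ^ 0 * x)"
      for z A B x :: complex by (simp add: algebra_simps power2_eq_square)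
    then show "(zsum s - (u + q / u)) * (zsum s - (v + q / v)) * wp_term n (4 * s)
      = zsum s ^ 2 * wp_term n (4 * s) - (u + q / u + (v + q / v)) * (zsum s ^ 1 * wp_term n (4 * s))
        + (u + q / u) * (v + q / v) * (zsum s ^ 0 * wp_term n (4 * s))" .
  qed
  also have "\<dots> = D * K6 q u v n * moment 0 (int n) n"
    unfolding D_def using moments_eq_K6[OF n _ nz nz'(1) nz''(1) nz'(2) nz''(2)] by simp
  also have "moment 0 (int n) n = qpoch (- (q\<^sup>2)) (q\<^sup>2) (n - 1) / qpoch q q (2 * n)"
  proof -
    obtain m where m: "n = Suc m" using n by (cases n) auto
    show ?thesis using wp_term_sum_eval[of m "int n"] by (simp add: m moment_def add.commute)
  qed
  finally show ?thesis using D0 by simp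
qed

lemma G_int_0: "generic_params q u v \<Longrightarrow> G_int u v 0 = 1"
  using G_eq_G_int[of u v 0] by (simp add: G_def qpochs_def qpoch_def)

section \<open>The two Bailey pairs\<close>

text \<open>For \<open>n \<le> 2\<close> the value of \<open>K6\<close> is 1 by convention and not
  given by \<open>K\<close>, so these cases are settled by hand; as \<open>\<alpha> 2 = 0\<close>,
  they involve only \<open>\<alpha> 0\<close> and \<open>\<alpha> 1\<close>.\<close>

lemma bailey_pair_rel_1_I:
  assumes "\<alpha> 0 = 1" "\<beta> 0 = 1" "\<alpha> 2 = 0"
    and "\<beta> 1 = (1 + q + \<alpha> 1) / qpoch q q 2"
    and "\<beta> 2 = ((1 + q\<^sup>2) * (1 + q + q\<^sup>2) + (1 + q) * (1 + q\<^sup>2) * \<alpha> 1) / qpoch q q 4"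
    and "\<And>n. 3 \<le> n \<Longrightarrow> \<beta> n = (\<Sum>j\<le>n. \<alpha> j / (qpoch q q (n - j) * qpoch q q (n + j)))"
  shows "bailey_pair q 1 \<alpha> \<beta>"
proof -
  have nz: "1 - q \<noteq> 0" "1 - q\<^sup>2 \<noteq> 0" "1 - q ^ 3 \<noteq> 0" "1 - q ^ 4 \<noteq> 0"
    using pow_fac_nz[of 1] pow_fac_nz[of 2] pow_fac_nz[of 3] pow_fac_nz[of 4] by simp_all
  have p1: "qpoch q q 0 = 1" "qpoch q q 1 = 1 - q"
    by (simp_all add: qpoch_def)
  have p2: "qpoch q q 2 = (1 - q) * (1 - q\<^sup>2)"
    using qpoch_Suc[of q q 1] p1 by (simp add: numeral_2_eq_2)
  have p3: "qpoch q q 3 = (1 - q) * (1 - q\<^sup>2) * (1 - q ^ 3)"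
    using qpoch_Suc[of q q 2] p2 by (simp add: numeral_3_eq_3 numeral_2_eq_2)
  have p4: "qpoch q q 4 = (1 - q) * (1 - q\<^sup>2) * (1 - q ^ 3) * (1 - q ^ 4)"
    using qpoch_Suc[of q q 3] p3 by (simp add: eval_nat_numeral)
  have "\<beta> n = (\<Sum>j\<le>n. \<alpha> j / (qpoch q q (n - j) * qpoch q q (n + j)))" for n
  proof -
    consider "n = 0" | "n = 1" | "n = 2" | "3 \<le> n" by linarith
    then show ?thesis
    proof cases
      case 1
      then show ?thesis using assms p1 by simp
    next
      case 2
      have "(1 + q + \<alpha> 1) / qpoch q q 2 = 1 / (qpoch q q 1 * qpoch q q 1) + \<alpha> 1 / (qpoch q q 0 * qpoch q q 2)"
        unfolding p1 p2 using nz by (simp add: divide_simps) algebra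
      with assms 2 show ?thesis by (simp add: numeral_2_eq_2)
    next
      case 3
      have "((1 + q\<^sup>2) * (1 + q + q\<^sup>2) + (1 + q) * (1 + q\<^sup>2) * \<alpha> 1) / qpoch q q 4
        = 1 / (qpoch q q 2 * qpoch q q 2) + \<alpha> 1 / (qpoch q q 1 * qpoch q q 3)"
        unfolding p1 p2 p3 p4 using nz by (simp add: divide_simps) algebra
      with assms 3 show ?thesis by (simp add: eval_nat_numeral)
    qed (use assms in auto)
  qed
  with assms(1) show ?thesis by (simp add: bailey_pair_def)
qed

lemma bailey_pair_i:
  assumes gen: "generic_params q u v"
    and "\<alpha> 0 = 1" "\<beta> 0 = 1" and a2: "\<And>r. \<alpha> (4 * r + 2) = 0"
    and a0: "\<And>r. r \<ge> 1 \<Longrightarrow> \<alpha> (4 * r) = G q u v r * q powi (8 * (int r)\<^sup>2 - 10 * int r)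
                          + H q u v r * q powi (8 * (int r)\<^sup>2 - 6 * int r)"
    and a1: "\<And>r. \<alpha> (4 * r + 1) = - G q u v r * q powi (8 * (int r)\<^sup>2 - 2 * int r + 1)"
    and a3: "\<And>r. r \<ge> 1 \<Longrightarrow> \<alpha> (4 * r - 1) = - H q u v r * q powi (8 * (int r)\<^sup>2 - 14 * int r + 1)"
    and b: "\<And>n. n \<ge> 1 \<Longrightarrow> \<beta> n = K6 q u v n * (qpoch (- (q\<^sup>2)) (q\<^sup>2) (n - 1) / qpoch q q (2 * n))"
  shows "bailey_pair q 1 \<alpha> \<beta>"
proof (rule bailey_pair_rel_1_I)
  show "\<alpha> 0 = 1" "\<beta> 0 = 1" "\<alpha> 2 = 0" using assms(2,3) a2[of 0] by (simp_all add: numeral_2_eq_2)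
  have \<alpha>1: "\<alpha> 1 = - q" using a1[of 0] G_int_0[OF gen] G_eq_G_int[OF gen, of 0] by simp
  show "\<beta> 1 = (1 + q + \<alpha> 1) / qpoch q q 2"
    unfolding \<alpha>1 using b[of 1] by (simp add: K6_def qpoch_def[of _ _ 0])
  have "(1 + q\<^sup>2) * (1 + q + q\<^sup>2) + (1 + q) * (1 + q\<^sup>2) * - q = 1 + q\<^sup>2" by algebra
  then show "\<beta> 2 = ((1 + q\<^sup>2) * (1 + q + q\<^sup>2) + (1 + q) * (1 + q\<^sup>2) * \<alpha> 1) / qpoch q q 4"
    unfolding \<alpha>1 using b[of 2] by (simp add: K6_def qpoch_def[of _ _ "Suc 0"])
  fix n :: nat assume n: "3 \<le> n"
  have "(\<Sum>j\<le>n. \<alpha> j / (qpoch q q (n - j) * qpoch q q (n + j)))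
    = (\<Sum>s\<in>{- int n..int n}. G_int u v s * q powi (8 * s\<^sup>2 - 10 * s) * rq (int n - 4 * s) * rq (int n + 4 * s)
        - G_int u v s * q powi (8 * s\<^sup>2 - 2 * s + 1) * rq (int n - 4 * s - 1) * rq (int n + 4 * s + 1))"
  proof (rule bailey_sum_fold)
    fix r :: nat assume r: "r \<ge> 1"
    \<comment> \<open>The factor \<open>q powi (16 * r)\<close> relating \<open>H\<close> to
      \<open>G_int\<close> turns the exponents attached to \<open>H\<close> into those attached to
      \<open>G\<close>, evaluated at \<open>s = - r\<close>.\<close>
    show "\<alpha> (4 * r) = G_int u v (int r) * q powi (8 * (int r)\<^sup>2 - 10 * int r)
       + G_int u v (- int r) * q powi (8 * (- int r)\<^sup>2 - 10 * - int r)"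
      using a0[OF r] q_nz by (simp add: G_eq_G_int[OF gen] H_eq_G_int[OF gen] mult_ac add_ac flip: power_int_add)
    show "\<alpha> (4 * r - 1) = - (G_int u v (- int r) * q powi (8 * (- int r)\<^sup>2 - 2 * - int r + 1))"
      using a3[OF r] q_nz by (simp add: H_eq_G_int[OF gen] mult_ac add_ac flip: power_int_add)
  qed (use assms(2) a1 a2 G_int_0[OF gen] G_eq_G_int[OF gen] in simp_all)
  also have "\<dots> = (\<Sum>s\<in>{- int n..int n}. G_int u v s * q powi (8 * s\<^sup>2 - 10 * s) * (1 - q powi (8 * s + 1))
      * rq (int n - 4 * s) * rq (int n + 4 * s + 1))"
  proof (intro sum.cong refl)
    fix s
    \<comment> \<open>The exponents of the even and odd parts differ by \<open>2 * j + 1\<close>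
      with \<open>j = 4 * s\<close>, the shape required by the first identity of
      \<open>rq_mix\<close>.\<close>
    have e: "q powi (8 * s\<^sup>2 - 2 * s + 1) = q powi (8 * s\<^sup>2 - 10 * s) * q powi (2 * (4 * s) + 1)"
      using q_nz by (simp add: algebra_simps flip: power_int_add)
    have "G_int u v s * q powi (8 * s\<^sup>2 - 10 * s) * rq (int n - 4 * s) * rq (int n + 4 * s)
        - G_int u v s * q powi (8 * s\<^sup>2 - 2 * s + 1) * rq (int n - 4 * s - 1) * rq (int n + 4 * s + 1)
      = G_int u v s * q powi (8 * s\<^sup>2 - 10 * s) * (rq (int n - 4 * s) * rq (int n + 4 * s)
        - q powi (2 * (4 * s) + 1) * rq (int n - 4 * s - 1) * rq (int n + 4 * s + 1))"
      unfolding e by (simp only: right_diff_distrib mult.assoc)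
    then show "G_int u v s * q powi (8 * s\<^sup>2 - 10 * s) * rq (int n - 4 * s) * rq (int n + 4 * s)
        - G_int u v s * q powi (8 * s\<^sup>2 - 2 * s + 1) * rq (int n - 4 * s - 1) * rq (int n + 4 * s + 1)
      = G_int u v s * q powi (8 * s\<^sup>2 - 10 * s) * (1 - q powi (8 * s + 1))
      * rq (int n - 4 * s) * rq (int n + 4 * s + 1)"
      unfolding rq_mix(1) by (simp add: mult.assoc)
  qed
  also have "\<dots> = \<beta> n" using bailey_sum_eval[OF gen n] b[of n] n by simp
  finally show "\<beta> n = (\<Sum>j\<le>n. \<alpha> j / (qpoch q q (n - j) * qpoch q q (n + j)))" ..
qed

lemma bailey_pair_ii:
  assumes gen: "generic_params q u v"
    and "\<alpha> 0 = 1" "\<beta> 0 = 1" and a2: "\<And>r. \<alpha> (4 * r + 2) = 0"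
    and a0: "\<And>r. r \<ge> 1 \<Longrightarrow> \<alpha> (4 * r) = G q u v r * q powi (8 * (int r)\<^sup>2 - 6 * int r)
                          + H q u v r * q powi (8 * (int r)\<^sup>2 - 10 * int r)"
    and a1: "\<And>r. \<alpha> (4 * r + 1) = - G q u v r * q powi (8 * (int r)\<^sup>2 - 6 * int r)"
    and a3: "\<And>r. r \<ge> 1 \<Longrightarrow> \<alpha> (4 * r - 1) = - H q u v r * q powi (8 * (int r)\<^sup>2 - 10 * int r)"
    and b: "\<And>n. n \<ge> 1 \<Longrightarrow> \<beta> n = K6 q u v n
                        * (q ^ n * qpoch (- (q\<^sup>2)) (q\<^sup>2) (n - 1) / qpoch q q (2 * n))"
  shows "bailey_pair q 1 \<alpha> \<beta>"
proof (rule bailey_pair_rel_1_I)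
  show "\<alpha> 0 = 1" "\<beta> 0 = 1" "\<alpha> 2 = 0" using assms(2,3) a2[of 0] by (simp_all add: numeral_2_eq_2)
  have \<alpha>1: "\<alpha> 1 = - 1" using a1[of 0] G_int_0[OF gen] G_eq_G_int[OF gen, of 0] by simp
  show "\<beta> 1 = (1 + q + \<alpha> 1) / qpoch q q 2"
    unfolding \<alpha>1 using b[of 1] by (simp add: K6_def qpoch_def[of _ _ 0])
  have "(1 + q\<^sup>2) * (1 + q + q\<^sup>2) + (1 + q) * (1 + q\<^sup>2) * - 1 = q\<^sup>2 * (1 + q\<^sup>2)" by algebra
  then show "\<beta> 2 = ((1 + q\<^sup>2) * (1 + q + q\<^sup>2) + (1 + q) * (1 + q\<^sup>2) * \<alpha> 1) / qpoch q q 4"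
    unfolding \<alpha>1 using b[of 2] by (simp add: K6_def qpoch_def[of _ _ "Suc 0"])
  fix n :: nat assume n: "3 \<le> n"
  have "(\<Sum>j\<le>n. \<alpha> j / (qpoch q q (n - j) * qpoch q q (n + j)))
    = (\<Sum>s\<in>{- int n..int n}. G_int u v s * q powi (8 * s\<^sup>2 - 6 * s) * rq (int n - 4 * s) * rq (int n + 4 * s)
        - G_int u v s * q powi (8 * s\<^sup>2 - 6 * s) * rq (int n - 4 * s - 1) * rq (int n + 4 * s + 1))"
  proof (rule bailey_sum_fold)
    fix r :: nat assume r: "r \<ge> 1"
    show "\<alpha> (4 * r) = G_int u v (int r) * q powi (8 * (int r)\<^sup>2 - 6 * int r)
       + G_int u v (- int r) * q powi (8 * (- int r)\<^sup>2 - 6 * - int r)"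
      using a0[OF r] q_nz by (simp add: G_eq_G_int[OF gen] H_eq_G_int[OF gen] mult_ac add_ac flip: power_int_add)
    show "\<alpha> (4 * r - 1) = - (G_int u v (- int r) * q powi (8 * (- int r)\<^sup>2 - 6 * - int r))"
      using a3[OF r] q_nz by (simp add: H_eq_G_int[OF gen] mult_ac add_ac flip: power_int_add)
  qed (use assms(2) a1 a2 G_int_0[OF gen] G_eq_G_int[OF gen] in simp_all)
  also have "\<dots> = (\<Sum>s\<in>{- int n..int n}. q ^ n * (G_int u v s * q powi (8 * s\<^sup>2 - 10 * s) * (1 - q powi (8 * s + 1))
      * rq (int n - 4 * s) * rq (int n + 4 * s + 1)))"
  proof (intro sum.cong refl)
    fix s
    \<comment> \<open>Here both parts carry the same exponent, so the second identity of
      \<open>rq_mix\<close> applies; its factor \<open>q powi (n - 4 * s)\<close> restores the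
      exponent of the first pair and leaves \<open>q ^ n\<close>.\<close>
    have e: "q powi (8 * s\<^sup>2 - 6 * s) * q powi (int n - 4 * s) = q ^ n * q powi (8 * s\<^sup>2 - 10 * s)"
    proof -
      have "q powi (8 * s\<^sup>2 - 6 * s) * q powi (int n - 4 * s) = q powi (int n + (8 * s\<^sup>2 - 10 * s))"
        using q_nz by (simp add: algebra_simps flip: power_int_add)
      then show ?thesis using power_int_add[of q "int n" "8 * s\<^sup>2 - 10 * s"] q_nz by simp
    qed
    have "G_int u v s * q powi (8 * s\<^sup>2 - 6 * s) * rq (int n - 4 * s) * rq (int n + 4 * s)
        - G_int u v s * q powi (8 * s\<^sup>2 - 6 * s) * rq (int n - 4 * s - 1) * rq (int n + 4 * s + 1)
      = G_int u v s * q powi (8 * s\<^sup>2 - 6 * s) * (rq (int n - 4 * s) * rq (int n + 4 * s)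
        - rq (int n - 4 * s - 1) * rq (int n + 4 * s + 1))"
      by (simp only: right_diff_distrib mult.assoc)
    also have "\<dots> = G_int u v s * (q powi (8 * s\<^sup>2 - 6 * s) * q powi (int n - 4 * s))
        * (1 - q powi (8 * s + 1)) * rq (int n - 4 * s) * rq (int n + 4 * s + 1)"
      unfolding rq_mix(2) by (simp add: mult.assoc)
    finally show "G_int u v s * q powi (8 * s\<^sup>2 - 6 * s) * rq (int n - 4 * s) * rq (int n + 4 * s)
        - G_int u v s * q powi (8 * s\<^sup>2 - 6 * s) * rq (int n - 4 * s - 1) * rq (int n + 4 * s + 1)
      = q ^ n * (G_int u v s * q powi (8 * s\<^sup>2 - 10 * s) * (1 - q powi (8 * s + 1))
      * rq (int n - 4 * s) * rq (int n + 4 * s + 1))"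
      unfolding e by (simp only: mult_ac)
  qed
  also have "\<dots> = \<beta> n"
    using bailey_sum_eval[OF gen n] b[of n] n by (simp flip: sum_distrib_left)
  finally show "\<beta> n = (\<Sum>j\<le>n. \<alpha> j / (qpoch q q (n - j) * qpoch q q (n + j)))" ..
qed

end

lemma generic_imp_non_root:
  assumes "generic_params q u v"
  shows "non_root_of_unity q"
proof
  show "q \<noteq> 0" using assms by (simp add: generic_params_def)
  fix k :: nat assume k: "k \<ge> 1"
  then obtain m where m: "k = Suc m" by (cases k) auto
  have "qpoch q q (Suc m) \<noteq> 0" using assms by (simp add: generic_params_def)
  then show "q ^ k \<noteq> 1" by (auto simp: m qpoch_def)
qed

theorem theorem2p14:
  fixes q u v :: complex
  assumes "generic_params q u v"
  shows
    "(\<forall>\<alpha> \<beta> :: nat \<Rightarrow> complex.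
        \<alpha> 0 = 1 \<and> \<beta> 0 = 1 \<and>
        (\<forall>r. \<alpha> (4 * r + 2) = 0) \<and>
        (\<forall>r\<ge>1. \<alpha> (4 * r) = G q u v r * q powi (8 * (int r)\<^sup>2 - 10 * int r)
                          + H q u v r * q powi (8 * (int r)\<^sup>2 - 6 * int r)) \<and>
        (\<forall>r. \<alpha> (4 * r + 1) = - G q u v r * q powi (8 * (int r)\<^sup>2 - 2 * int r + 1)) \<and>
        (\<forall>r\<ge>1. \<alpha> (4 * r - 1) = - H q u v r * q powi (8 * (int r)\<^sup>2 - 14 * int r + 1)) \<and>
        (\<forall>n\<ge>1. \<beta> n = K6 q u v n * (qpoch (- (q\<^sup>2)) (q\<^sup>2) (n - 1) / qpoch q q (2 * n)))
        \<longrightarrow> bailey_pair q 1 \<alpha> \<beta>)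
     \<and>
     (\<forall>\<alpha> \<beta> :: nat \<Rightarrow> complex.
        \<alpha> 0 = 1 \<and> \<beta> 0 = 1 \<and>
        (\<forall>r. \<alpha> (4 * r + 2) = 0) \<and>
        (\<forall>r\<ge>1. \<alpha> (4 * r) = G q u v r * q powi (8 * (int r)\<^sup>2 - 6 * int r)
                          + H q u v r * q powi (8 * (int r)\<^sup>2 - 10 * int r)) \<and>
        (\<forall>r. \<alpha> (4 * r + 1) = - G q u v r * q powi (8 * (int r)\<^sup>2 - 6 * int r)) \<and>
        (\<forall>r\<ge>1. \<alpha> (4 * r - 1) = - H q u v r * q powi (8 * (int r)\<^sup>2 - 10 * int r)) \<and>
        (\<forall>n\<ge>1. \<beta> n = K6 q u v n
                        * (q ^ n * qpoch (- (q\<^sup>2)) (q\<^sup>2) (n - 1) / qpoch q q (2 * n)))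
        \<longrightarrow> bailey_pair q 1 \<alpha> \<beta>)"
proof -
  interpret non_root_of_unity q using assms by (rule generic_imp_non_root)
  show ?thesis
    using bailey_pair_i[OF assms] bailey_pair_ii[OF assms] by (intro conjI allI impI) blast+
qed

end
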